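(* Suppose that for each $1\le j\le p$ the term $n^{-1}\boldsymbol{\psi}_j^\top\boldsymbol{\epsilon}$ follows a Gaussian distribution $N(0,\sigma^2/n)$. Let $\hat{\boldsymbol{\mu}}_{\hat{\mathbf{w}}_2|\mathcal{M}_U}$ be the Adap estimator. If $p$ is fixed, there exists a constant $\bar{C}>1$, independent of $n$, such that $$\max_{\boldsymbol{\mu}\in\mathbb{R}^n}\frac{R_n(\hat{\boldsymbol{\mu}}_{\hat{\mathbf{w}}_2|\mathcal{M}_U},\boldsymbol{\mu})}{n^{-1}+R_n(\hat{\boldsymbol{\mu}}_{\mathbf{w}^*|\mathcal{M}_{AS}},\boldsymbol{\mu})}\le\bar{C}.$$ If $p\to\infty$ as $n\to\infty$, then $$\max_{\boldsymbol{\mu}\in\mathbb{R}^n}\frac{R_n(\hat{\boldsymbol{\mu}}_{\hat{\mathbf{w}}_2|\mathcal{M}_U},\boldsymbol{\mu})}{n^{-1}+R_n(\hat{\boldsymbol{\mu}}_{\mathbf{w}^*|\mathcal{M}_{AS}},\boldsymbol{\mu})}\le[1+o(1)]\,2\log p .$$ Here the maxima are over all $\boldsymbol{\mu}\in\mathbb{R}^n$ of the form $\boldsymbol{\mu}=\sum_{j=1}^p\theta_j\boldsymbol{\psi}_j$ with $\theta_1,\dots,\theta_p\in\mathbb{R}$.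
   Context: Model: $\mathbf{y}=\boldsymbol{\mu}+\boldsymbol{\epsilon}$ in $\mathbb{R}^n$, where $\boldsymbol{\epsilon}=(\epsilon_1,\dots,\epsilon_n)^\top$ has independent components with mean zero and variance $\sigma^2$ ($\sigma^2>0$ does not depend on $n$ and is known). $\|\cdot\|$ is the Euclidean norm. For an estimator $\hat{\boldsymbol{\mu}}$ the risk is $R_n(\hat{\boldsymbol{\mu}},\boldsymbol{\mu})=n^{-1}\mathbb{E}\|\hat{\boldsymbol{\mu}}-\boldsymbol{\mu}\|^2$. "$\max$" is understood as supremum; $o(1)$ denotes a quantity tending to $0$ as $n\to\infty$. Complete orthogonal basis: $\boldsymbol{\psi}_1,\dots,\boldsymbol{\psi}_p\in\mathbb{R}^n$ ($1\le p\le n$) are given with $n^{-1}\|\boldsymbol{\psi}_j\|^2=1$ and $\boldsymbol{\psi}_j^\top\boldsymbol{\psi}_{j'}=0$ for $j\ne j'$, and the true mean vector has the representation $\boldsymbol{\mu}=\sum_{j=1}^p\theta_j\boldsymbol{\psi}_j$. All-subset model averaging: for $\mathcal{I}\subseteq\{1,\dots,p\}$ let $\hat{\boldsymbol{\mu}}_{\mathcal{I}}$ be the orthogonal projection of $\mathbf{y}$ onto $\operatorname{span}\{\boldsymbol{\psi}_j:j\in\mathcal{I}\}$ (so $\hat{\boldsymbol{\mu}}_{\emptyset}=\boldsymbol 0$). Let $\mathcal{M}_{AS}=\{\mathcal{I}:\mathcal{I}\subseteq\{1,\dots,p\}\}$, and for weights $\mathbf{w}=(w_{\mathcal{I}})_{\mathcal{I}}$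 with $w_{\mathcal{I}}\in[0,1]$ and $\sum_{\mathcal{I}}w_{\mathcal{I}}=1$ let $\hat{\boldsymbol{\mu}}_{\mathbf{w}|\mathcal{M}_{AS}}=\sum_{\mathcal{I}}w_{\mathcal{I}}\hat{\boldsymbol{\mu}}_{\mathcal{I}}$. The optimal all-subset model averaging risk is $R_n(\hat{\boldsymbol{\mu}}_{\mathbf{w}^*|\mathcal{M}_{AS}},\boldsymbol{\mu})=\min_{\mathbf{w}}R_n(\hat{\boldsymbol{\mu}}_{\mathbf{w}|\mathcal{M}_{AS}},\boldsymbol{\mu})$, the minimum being over such deterministic weights. Adap estimator: let $\mathcal{M}_U=\{\{1\},\{2\},\dots,\{p\}\}$, $\tilde{\theta}_j=n^{-1}\boldsymbol{\psi}_j^\top\mathbf{y}$, $\hat{\boldsymbol{\mu}}_j=\tilde{\theta}_j\boldsymbol{\psi}_j$, and $\lambda_2=\sqrt{(2\log p)/n}$. Define $$\hat{\mathbf{w}}_2=\operatorname*{argmin}_{\mathbf{w}\in[0,1]^p}\Bigl\{n^{-1}\Bigl\|\mathbf{y}-\sum_{j=1}^pw_j\hat{\boldsymbol{\mu}}_j\Bigr\|^2+2\lambda_2^2\sigma^2\sum_{j=1}^pw_j\Bigr\},\qquad \hat{\boldsymbol{\mu}}_{\hat{\mathbf{w}}_2|\mathcal{M}_U}=\sum_{j=1}^p\hat{w}_{2j}\tilde{\theta}_j\boldsymbol{\psi}_j .$$ *)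

theory Defs
  imports "HOL-Probability.Probability"
begin

(* The dimension n varies inside the statement, so a vector of R^n is a function
   v :: nat => real of which only the coordinates v 1, ..., v n are ever used;
   its Euclidean norm is L2_set v {1..n}.  Here psi j i is the i-th coordinate of
   the j-th basis vector. *)

definition inner_n :: "nat \<Rightarrow> (nat \<Rightarrow> real) \<Rightarrow> (nat \<Rightarrow> real) \<Rightarrow> real" where
  "inner_n n u v = (\<Sum>i=1..n. u i * v i)"

definition lin_span :: "(nat \<Rightarrow> nat \<Rightarrow> real) \<Rightarrow> nat set \<Rightarrow> (nat \<Rightarrow> real) set" where
  "lin_span \<psi> I = range (\<lambda>\<theta> i. \<Sum>j\<in>I. \<theta> j * \<psi> j i)"

definition orthogonal_basis :: "nat \<Rightarrow> nat \<Rightarrow> (nat \<Rightarrow> nat \<Rightarrow> real) \<Rightarrow> bool" where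
  "orthogonal_basis n p \<psi> \<longleftrightarrow>
     (\<forall>j\<in>{1..p}. (L2_set (\<psi> j) {1..n})\<^sup>2 / real n = 1) \<and>
     (\<forall>j\<in>{1..p}. \<forall>k\<in>{1..p}. j \<noteq> k \<longrightarrow> inner_n n (\<psi> j) (\<psi> k) = 0)"

(* The square-integrability clause makes the (Bochner) expectation and variance
   genuine rather than default values. *)
definition noise_model :: "'a measure \<Rightarrow> nat \<Rightarrow> real \<Rightarrow> (nat \<Rightarrow> 'a \<Rightarrow> real) \<Rightarrow> bool" where
  "noise_model M n \<sigma> \<epsilon> \<longleftrightarrow>
     prob_space M \<and>
     prob_space.indep_vars M (\<lambda>_. borel) \<epsilon> {1..n} \<and>
     (\<forall>i\<in>{1..n}. integrable M (\<lambda>\<omega>. (\<epsilon> i \<omega>)\<^sup>2) \<and>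
        prob_space.expectation M (\<epsilon> i) = 0 \<and>
        prob_space.variance M (\<epsilon> i) = \<sigma>\<^sup>2)"

(* An estimator maps the data y to an element of R^n. *)
definition risk :: "'a measure \<Rightarrow> nat \<Rightarrow> (nat \<Rightarrow> 'a \<Rightarrow> real) \<Rightarrow>
    ((nat \<Rightarrow> real) \<Rightarrow> nat \<Rightarrow> real) \<Rightarrow> (nat \<Rightarrow> real) \<Rightarrow> real" where
  "risk M n \<epsilon> est \<mu> =
     prob_space.expectation M
       (\<lambda>\<omega>. (L2_set (\<lambda>i. est (\<lambda>k. \<mu> k + \<epsilon> k \<omega>) i - \<mu> i) {1..n})\<^sup>2) / real n"

(* Orthogonal projection onto the span of the psi j, j in I; it exists and is unique
   whenever the psi j are linearly independent in R^n. *)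
definition proj_est :: "nat \<Rightarrow> (nat \<Rightarrow> nat \<Rightarrow> real) \<Rightarrow> nat set \<Rightarrow>
    (nat \<Rightarrow> real) \<Rightarrow> nat \<Rightarrow> real" where
  "proj_est n \<psi> I y =
     (THE v. v \<in> lin_span \<psi> I \<and>
        (\<forall>u\<in>lin_span \<psi> I. inner_n n (\<lambda>i. y i - v i) u = 0))"

definition AS_weights :: "nat \<Rightarrow> (nat set \<Rightarrow> real) set" where
  "AS_weights p = {w \<in> Pow {1..p} \<rightarrow>\<^sub>E {0..1}. (\<Sum>I\<in>Pow {1..p}. w I) = 1}"

definition AS_est :: "nat \<Rightarrow> nat \<Rightarrow> (nat \<Rightarrow> nat \<Rightarrow> real) \<Rightarrow> (nat set \<Rightarrow> real) \<Rightarrow>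
    (nat \<Rightarrow> real) \<Rightarrow> nat \<Rightarrow> real" where
  "AS_est n p \<psi> w y = (\<lambda>i. \<Sum>I\<in>Pow {1..p}. w I * proj_est n \<psi> I y i)"

(* The infimum is over a nonempty set of nonnegative reals and is attained. *)
definition AS_opt_risk :: "'a measure \<Rightarrow> nat \<Rightarrow> nat \<Rightarrow> (nat \<Rightarrow> 'a \<Rightarrow> real) \<Rightarrow>
    (nat \<Rightarrow> nat \<Rightarrow> real) \<Rightarrow> (nat \<Rightarrow> real) \<Rightarrow> real" where
  "AS_opt_risk M n p \<epsilon> \<psi> \<mu> = (INF w\<in>AS_weights p. risk M n \<epsilon> (AS_est n p \<psi> w) \<mu>)"

definition theta_tilde :: "nat \<Rightarrow> (nat \<Rightarrow> nat \<Rightarrow> real) \<Rightarrow> (nat \<Rightarrow> real) \<Rightarrow> nat \<Rightarrow> real" where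
  "theta_tilde n \<psi> y j = inner_n n (\<psi> j) y / real n"

definition single_est :: "nat \<Rightarrow> (nat \<Rightarrow> nat \<Rightarrow> real) \<Rightarrow> (nat \<Rightarrow> real) \<Rightarrow>
    nat \<Rightarrow> nat \<Rightarrow> real" where
  "single_est n \<psi> y j = (\<lambda>i. theta_tilde n \<psi> y j * \<psi> j i)"

definition lambda2 :: "nat \<Rightarrow> nat \<Rightarrow> real" where
  "lambda2 n p = sqrt (2 * ln (real p) / real n)"

definition adap_criterion :: "nat \<Rightarrow> nat \<Rightarrow> (nat \<Rightarrow> nat \<Rightarrow> real) \<Rightarrow> real \<Rightarrow>
    (nat \<Rightarrow> real) \<Rightarrow> (nat \<Rightarrow> real) \<Rightarrow> real" where
  "adap_criterion n p \<psi> \<sigma> y w =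
     (L2_set (\<lambda>i. y i - (\<Sum>j=1..p. w j * single_est n \<psi> y j i)) {1..n})\<^sup>2 / real n
     + 2 * (lambda2 n p)\<^sup>2 * \<sigma>\<^sup>2 * (\<Sum>j=1..p. w j)"

(* For an orthogonal basis the minimiser exists, and it is unique except when p = 1 and
   theta_tilde 1 = 0; the estimator adap_est does not depend on the choice then. *)
definition adap_weights :: "nat \<Rightarrow> nat \<Rightarrow> (nat \<Rightarrow> nat \<Rightarrow> real) \<Rightarrow> real \<Rightarrow>
    (nat \<Rightarrow> real) \<Rightarrow> nat \<Rightarrow> real" where
  "adap_weights n p \<psi> \<sigma> y =
     arg_min (adap_criterion n p \<psi> \<sigma> y) (\<lambda>w. w \<in> {1..p} \<rightarrow>\<^sub>E {0..1})"

definition adap_est :: "nat \<Rightarrow> nat \<Rightarrow> (nat \<Rightarrow> nat \<Rightarrow> real) \<Rightarrow> real \<Rightarrow>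
    (nat \<Rightarrow> real) \<Rightarrow> nat \<Rightarrow> real" where
  "adap_est n p \<psi> \<sigma> y =
     (\<lambda>i. \<Sum>j=1..p. adap_weights n p \<psi> \<sigma> y j * single_est n \<psi> y j i)"

(* Supremum in the extended reals, so that it is meaningful without a boundedness proof. *)
definition max_risk_ratio :: "'a measure \<Rightarrow> nat \<Rightarrow> nat \<Rightarrow> (nat \<Rightarrow> 'a \<Rightarrow> real) \<Rightarrow>
    (nat \<Rightarrow> nat \<Rightarrow> real) \<Rightarrow> real \<Rightarrow> ereal" where
  "max_risk_ratio M n p \<epsilon> \<psi> \<sigma> =
     (SUP \<mu>\<in>lin_span \<psi> {1..p}.
        ereal (risk M n \<epsilon> (adap_est n p \<psi> \<sigma>) \<mu> / (1 / real n + AS_opt_risk M n p \<epsilon> \<psi> \<mu>)))"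

end

theory Submission
  imports Defs "HOL-Real_Asymp.Real_Asymp"
begin

text \<open>
  In the coordinates of the orthogonal basis both estimators split into \<open>p\<close> scalar problems, each
  of estimating \<open>\<theta>\<close> from one observation \<open>x = \<theta> + X\<close> with \<open>X\<close> Gaussian of variance
  \<open>s\<^sup>2 = \<sigma>\<^sup>2 / n\<close>. An all-subset average multiplies \<open>x\<close> by the total weight of the subsets that
  contain the coordinate (\<open>AS_est_eq\<close>), and a linear rule \<open>c * x\<close> never has risk below the ideal
  value \<open>\<theta>\<^sup>2 * s\<^sup>2 / (\<theta>\<^sup>2 + s\<^sup>2)\<close> (\<open>linear_risk_ge_oracle\<close>). The adaptive criterion is a separable
  quadratic in the weights, and minimising it turns \<open>x\<close> into \<open>x - t\<^sup>2 / x\<close> when \<open>\<bar>x\<bar> > t\<close> and into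
  \<open>0\<close> otherwise, with threshold \<open>t = a * s\<close>, \<open>a = sqrt (2 * ln p)\<close> (\<open>adap_est_eq\<close>). This is the
  nonnegative garrote.

  It remains to compare two scalar risks. Two crude bounds for the garrote suffice. It moves its
  argument by at most \<open>t\<close>, so its risk is at most \<open>(1 + a)\<^sup>2 * s\<^sup>2\<close>. It is also Lipschitz with constant
  2, so its error at \<open>\<theta> + X\<close> is at most its output at \<open>X\<close> plus \<open>3 * \<bar>\<theta>\<bar>\<close>; the output on pure noise
  vanishes unless the noise passes the threshold, which contributes \<open>8 * s\<^sup>2 * exp (- a\<^sup>2 / 2)\<close>, and
  the risk is at most this plus \<open>18 * \<theta>\<^sup>2\<close>. A number that is at most \<open>A * \<theta>\<^sup>2\<close> and at most
  \<open>B * s\<^sup>2\<close> is at most \<open>A + B\<close> times the ideal risk, so the garrote has at most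
  \<open>18 + (1 + a)\<^sup>2\<close> times the ideal risk, up to that remainder (\<open>garrote_risk_le_oracle\<close>).

  The choice of \<open>a\<close> makes \<open>exp (- a\<^sup>2 / 2) = 1 / p\<close>, so the \<open>p\<close> remainders add up to
  \<open>8 * \<sigma>\<^sup>2 / n\<close>, which the term \<open>1 / n\<close> in the denominator absorbs. Thus the ratio is at most the
  maximum of \<open>8 * \<sigma>\<^sup>2\<close> and \<open>18 + (1 + a)\<^sup>2\<close>, a quantity that depends on \<open>n\<close> only through \<open>p\<close> and is
  asymptotic to \<open>a\<^sup>2 = 2 * ln p\<close> as \<open>p\<close> grows.
\<close>

section \<open>Coordinates in an orthogonal basis\<close>

lemma L2_set_power2: "(L2_set f A)\<^sup>2 = (\<Sum>i\<in>A. (f i)\<^sup>2)"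
  by (simp add: L2_set_def sum_nonneg)

lemma L2_set_inner_n: "(L2_set u {1..n})\<^sup>2 = inner_n n u u"
  unfolding L2_set_power2 by (simp add: inner_n_def power2_eq_square)

lemma inner_n_add_right: "inner_n n u (\<lambda>i. v i + w i) = inner_n n u v + inner_n n u w"
  by (simp add: inner_n_def algebra_simps sum.distrib)

lemma inner_n_diff_left: "inner_n n (\<lambda>i. u i - v i) w = inner_n n u w - inner_n n v w"
  by (simp add: inner_n_def algebra_simps sum_subtractf)

lemma inner_n_commute: "inner_n n u v = inner_n n v u"
  by (simp add: inner_n_def mult.commute)

lemma inner_n_sum_left:
  "inner_n n (\<lambda>i. \<Sum>j\<in>I. c j * \<psi> j i) u = (\<Sum>j\<in>I. c j * inner_n n (\<psi> j) u)"
  unfolding inner_n_def sum_distrib_left sum_distrib_right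
  by (subst sum.swap) (simp add: mult.assoc)

lemma orthogonal_basis_inner:
  assumes "orthogonal_basis n p \<psi>" "n \<ge> 1" "j \<in> {1..p}" "k \<in> {1..p}"
  shows "inner_n n (\<psi> j) (\<psi> k) = (if j = k then real n else 0)"
proof -
  have "(L2_set (\<psi> j) {1..n})\<^sup>2 = real n"
    using assms unfolding orthogonal_basis_def by (auto simp: field_simps)
  then have "inner_n n (\<psi> j) (\<psi> j) = real n"
    by (simp add: L2_set_inner_n del: One_nat_def)
  then show ?thesis
    using assms unfolding orthogonal_basis_def by auto
qed

lemma theta_tilde_span:
  assumes "orthogonal_basis n p \<psi>" "n \<ge> 1" "I \<subseteq> {1..p}" "k \<in> {1..p}"
  shows "theta_tilde n \<psi> (\<lambda>i. \<Sum>j\<in>I. c j * \<psi> j i) k = (if k \<in> I then c k else 0)"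
proof -
  have "finite I"
    using assms(3) finite_subset by blast
  have "inner_n n (\<psi> k) (\<lambda>i. \<Sum>j\<in>I. c j * \<psi> j i)
      = (\<Sum>j\<in>I. c j * (if j = k then real n else 0))"
    unfolding inner_n_commute[of n "\<psi> k"] inner_n_sum_left
    using assms by (intro sum.cong) (auto simp: orthogonal_basis_inner subset_iff)
  also have "\<dots> = (\<Sum>j\<in>I. if j = k then c k * real n else 0)"
    by (intro sum.cong) auto
  also have "\<dots> = (if k \<in> I then c k * real n else 0)"
    using \<open>finite I\<close> by simp
  finally show ?thesis
    using assms(2) by (simp add: theta_tilde_def)
qed

lemma inner_n_span_left:
  "inner_n n (\<lambda>i. \<Sum>j\<in>I. c j * \<psi> j i) u / real n = (\<Sum>j\<in>I. c j * theta_tilde n \<psi> u j)"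
  by (simp add: inner_n_sum_left theta_tilde_def sum_divide_distrib)

lemma parseval:
  assumes "orthogonal_basis n p \<psi>" "n \<ge> 1"
  shows "(L2_set (\<lambda>i. \<Sum>j=1..p. c j * \<psi> j i) {1..n})\<^sup>2 / real n = (\<Sum>j=1..p. (c j)\<^sup>2)"
proof -
  let ?v = "\<lambda>i. \<Sum>j=1..p. c j * \<psi> j i"
  have "(L2_set ?v {1..n})\<^sup>2 / real n = inner_n n ?v ?v / real n"
    by (simp add: L2_set_inner_n del: One_nat_def)
  also have "\<dots> = (\<Sum>j=1..p. c j * theta_tilde n \<psi> ?v j)"
    by (rule inner_n_span_left)
  also have "\<dots> = (\<Sum>j=1..p. (c j)\<^sup>2)"
    by (intro sum.cong) (simp_all add: theta_tilde_span[OF assms] power2_eq_square)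
  finally show ?thesis .
qed

lemma theta_tilde_signal_plus_noise:
  assumes "orthogonal_basis n p \<psi>" "n \<ge> 1" "k \<in> {1..p}"
  shows "theta_tilde n \<psi> (\<lambda>i. (\<Sum>j=1..p. \<theta> j * \<psi> j i) + e i) k
           = \<theta> k + inner_n n (\<psi> k) e / real n"
  using theta_tilde_span[OF assms(1,2) order_refl assms(3), of \<theta>] assms(3)
  by (simp add: theta_tilde_def inner_n_add_right add_divide_distrib)

text \<open>
  An estimator with values in the span of the basis has, by Parseval's identity, a loss that is a sum
  over coordinates; this is what reduces the comparison to scalar problems.
\<close>

lemma risk_coordinates:
  assumes "orthogonal_basis n p \<psi>" "n \<ge> 1"
    and "\<And>\<omega> i. est (\<lambda>k. (\<Sum>j=1..p. \<theta> j * \<psi> j k) + \<epsilon> k \<omega>) i = (\<Sum>j=1..p. d \<omega> j * \<psi> j i)"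
  shows "risk M n \<epsilon> est (\<lambda>i. \<Sum>j=1..p. \<theta> j * \<psi> j i)
           = (\<integral>\<omega>. (\<Sum>j=1..p. (d \<omega> j - \<theta> j)\<^sup>2) \<partial>M)"
proof -
  have "(L2_set (\<lambda>i. est (\<lambda>k. (\<Sum>j=1..p. \<theta> j * \<psi> j k) + \<epsilon> k \<omega>) i - (\<Sum>j=1..p. \<theta> j * \<psi> j i)) {1..n})\<^sup>2
      = real n * (\<Sum>j=1..p. (d \<omega> j - \<theta> j)\<^sup>2)" for \<omega>
    using parseval[OF assms(1,2), of "\<lambda>j. d \<omega> j - \<theta> j"] assms(2)
    by (simp add: assms(3) left_diff_distrib sum_subtractf nonzero_divide_eq_eq mult.commute[of "real n"]
        del: One_nat_def)
  then show ?thesis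
    using assms(2) by (simp add: risk_def)
qed

section \<open>All-subset averages shrink each coordinate\<close>

text \<open>
  The residual \<open>y - v\<close> of \<open>v = (\<Sum>j\<in>I. c j * \<psi> j)\<close> has inner product \<open>n * (theta_tilde k - c k)\<close> with
  \<open>\<psi> k\<close>, so orthogonality to the span determines every coefficient of the projection. Hence \<open>v\<close> is
  determined as a function on all indices, also beyond \<open>{1..n}\<close>, where the inner product sees
  nothing.
\<close>

lemma proj_est_eq:
  assumes ob: "orthogonal_basis n p \<psi>" and n: "n \<ge> 1" and I: "I \<subseteq> {1..p}"
  shows "proj_est n \<psi> I y = (\<lambda>i. \<Sum>j\<in>I. theta_tilde n \<psi> y j * \<psi> j i)"
proof -
  have fin: "finite I"
    using I finite_subset by blast
  let ?P = "\<lambda>v. v \<in> lin_span \<psi> I \<and>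
        (\<forall>u\<in>lin_span \<psi> I. inner_n n (\<lambda>i. y i - v i) u = 0)"
  let ?s = "\<lambda>c i. \<Sum>j\<in>I. c j * \<psi> j i"
  have resid: "inner_n n (\<lambda>i. y i - ?s c i) (\<psi> k) / real n
      = theta_tilde n \<psi> y k - c k" if "k \<in> I" for c k
    using theta_tilde_span[OF ob n I, of k c] that I
    by (auto simp: theta_tilde_def inner_n_diff_left diff_divide_distrib inner_n_commute[of n "\<psi> k"])
  have "?P (?s (theta_tilde n \<psi> y))"
  proof (intro conjI ballI)
    show "?s (theta_tilde n \<psi> y) \<in> lin_span \<psi> I"
      by (auto simp: lin_span_def)
  next
    fix u assume "u \<in> lin_span \<psi> I"
    then obtain c where u: "u = ?s c"
      by (auto simp: lin_span_def)
    have "inner_n n (\<psi> j) (\<lambda>i. y i - ?s (theta_tilde n \<psi> y) i) = 0" if "j \<in> I" for j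
      using resid[OF that, of "theta_tilde n \<psi> y"] n by (simp add: inner_n_commute)
    then show "inner_n n (\<lambda>i. y i - ?s (theta_tilde n \<psi> y) i) u = 0"
      unfolding u inner_n_commute[of n _ "?s c"] inner_n_sum_left by simp
  qed
  moreover have "v = ?s (theta_tilde n \<psi> y)" if "?P v" for v
  proof -
    from that have "v \<in> lin_span \<psi> I"
      by (rule conjunct1)
    then obtain c where v: "v = ?s c"
      by (auto simp: lin_span_def)
    have "\<psi> k \<in> lin_span \<psi> I" if "k \<in> I" for k
    proof -
      have "\<psi> k = (\<lambda>i. \<Sum>j\<in>I. of_bool (j = k) * \<psi> j i)"
        using that fin by (simp add: of_bool_def if_distrib[where f="\<lambda>x. x * _"] cong: if_cong)
      then show ?thesis
        unfolding lin_span_def by (rule range_eqI[where x="\<lambda>j. of_bool (j = k)"])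
    qed
    then have "c k = theta_tilde n \<psi> y k" if "k \<in> I" for k
      using resid[OF that, of c] that \<open>?P v\<close> unfolding v by auto
    then show ?thesis
      unfolding v by (intro ext sum.cong) auto
  qed
  ultimately show ?thesis
    unfolding proj_est_def by (rule the_equality)
qed

lemma AS_est_eq:
  assumes "orthogonal_basis n p \<psi>" "n \<ge> 1"
  shows "AS_est n p \<psi> w y i
    = (\<Sum>j=1..p. ((\<Sum>I | I \<subseteq> {1..p} \<and> j \<in> I. w I) * theta_tilde n \<psi> y j) * \<psi> j i)"
proof -
  have "AS_est n p \<psi> w y i = (\<Sum>I\<in>Pow {1..p}. \<Sum>j\<in>I. w I * (theta_tilde n \<psi> y j * \<psi> j i))"
    unfolding AS_est_def
    by (intro sum.cong) (auto simp: proj_est_eq[OF assms] sum_distrib_left)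
  also have "\<dots> = (\<Sum>I\<in>Pow {1..p}. \<Sum>j | j \<in> {1..p} \<and> j \<in> I. w I * (theta_tilde n \<psi> y j * \<psi> j i))"
    by (intro sum.cong) auto
  also have "\<dots> = (\<Sum>j=1..p. \<Sum>I | I \<in> Pow {1..p} \<and> j \<in> I. w I * (theta_tilde n \<psi> y j * \<psi> j i))"
    by (rule sum.swap_restrict) auto
  finally show ?thesis
    by (simp add: sum_distrib_right mult.assoc)
qed

lemma AS_weights_nonempty: "AS_weights p \<noteq> {}"
proof -
  have "restrict (\<lambda>I. of_bool (I = {})) (Pow {1..p}) \<in> AS_weights p"
    by (auto simp: AS_weights_def of_bool_def)
  then show ?thesis by blast
qed

section \<open>The adaptive estimator is garrote thresholding\<close>

text \<open>
  The thresholding rule of the nonnegative garrote, continuous at \<open>\<bar>x\<bar> = t\<close>. The case distinction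
  with \<open>\<le>\<close> keeps \<open>x = 0\<close> away from the quotient for every threshold \<open>t \<ge> 0\<close>.
\<close>

definition garrote :: "real \<Rightarrow> real \<Rightarrow> real" where
  "garrote t x = (if \<bar>x\<bar> \<le> t then 0 else x - t\<^sup>2 / x)"

definition garrote_weight :: "real \<Rightarrow> real \<Rightarrow> real" where
  "garrote_weight t x = (if \<bar>x\<bar> \<le> t then 0 else 1 - t\<^sup>2 / x\<^sup>2)"

lemma garrote_weight_mult: "t \<ge> 0 \<Longrightarrow> garrote_weight t x * x = garrote t x"
  by (auto simp: garrote_weight_def garrote_def field_simps power2_eq_square)

lemma garrote_weight_bounds: 
  assumes "t \<ge> 0"
  shows "garrote_weight t x \<in> {0..1}"
proof (cases "\<bar>x\<bar> \<le> t")
  case False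
  then have "t\<^sup>2 \<le> x\<^sup>2"
    using assms by (intro abs_le_square_iff[THEN iffD1]) auto
  with False assms show ?thesis
    by (auto simp: garrote_weight_def field_simps)
qed (auto simp: garrote_weight_def)

text \<open>
  The part of the criterion that involves a single weight is a quadratic \<open>q\<close> with leading
  coefficient \<open>x\<^sup>2\<close>. It grows quadratically away from its minimiser over \<open>w \<ge> 0\<close>: exactly so when
  the derivative vanishes there, and at least so when the minimum is at the boundary point \<open>0\<close>.
  The factor \<open>x\<^sup>2\<close> says that minimisers may differ only where \<open>x = 0\<close>, which does not affect the
  fitted coefficient \<open>w * x\<close>.
\<close>

lemma garrote_weight_growth:
  fixes t w x :: real
  assumes "t \<ge> 0" "w \<ge> 0"
  defines "q \<equiv> \<lambda>w. (w\<^sup>2 - 2 * w) * x\<^sup>2 + 2 * t\<^sup>2 * w"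
  shows "q (garrote_weight t x) + x\<^sup>2 * (w - garrote_weight t x)\<^sup>2 \<le> q w"
proof (cases "\<bar>x\<bar> \<le> t")
  case True
  then have "x\<^sup>2 \<le> t\<^sup>2"
    using assms by (intro abs_le_square_iff[THEN iffD1]) auto
  then have "x\<^sup>2 * w \<le> t\<^sup>2 * w"
    using assms by (intro mult_right_mono)
  with True show ?thesis
    by (simp add: q_def garrote_weight_def algebra_simps)
next
  case False
  then have "x \<noteq> 0" using assms by auto
  then have "x\<^sup>2 * garrote_weight t x = x\<^sup>2 - t\<^sup>2"
    using False by (simp add: garrote_weight_def field_simps)
  then have "t\<^sup>2 = x\<^sup>2 - x\<^sup>2 * garrote_weight t x"
    by simp
  then have "q (garrote_weight t x) + x\<^sup>2 * (w - garrote_weight t x)\<^sup>2 = q w"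
    unfolding q_def by algebra
  then show ?thesis by simp
qed

text \<open>
  Expanding the square, orthogonality removes all cross terms between different weights.
\<close>

lemma adap_criterion_eq:
  assumes "orthogonal_basis n p \<psi>" "n \<ge> 1"
  shows "adap_criterion n p \<psi> \<sigma> y w = (\<Sum>i=1..n. (y i)\<^sup>2) / real n
    + (\<Sum>j=1..p. ((w j)\<^sup>2 - 2 * w j) * (theta_tilde n \<psi> y j)\<^sup>2 + 2 * (lambda2 n p * \<sigma>)\<^sup>2 * w j)"
proof -
  let ?v = "\<lambda>i. \<Sum>j=1..p. (w j * theta_tilde n \<psi> y j) * \<psi> j i"
  have v: "(\<Sum>j=1..p. w j * single_est n \<psi> y j i) = ?v i" for i
    by (simp add: single_est_def mult.assoc)
  have "(L2_set (\<lambda>i. y i - ?v i) {1..n})\<^sup>2 / real n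
      = (\<Sum>i=1..n. (y i)\<^sup>2) / real n - 2 * (inner_n n ?v y / real n) + (L2_set ?v {1..n})\<^sup>2 / real n"
    by (simp add: L2_set_power2 inner_n_def power2_diff sum.distrib sum_subtractf
        sum_distrib_left add_divide_distrib diff_divide_distrib mult_ac)
  also have "\<dots> = (\<Sum>i=1..n. (y i)\<^sup>2) / real n
     + (\<Sum>j=1..p. ((w j)\<^sup>2 - 2 * w j) * (theta_tilde n \<psi> y j)\<^sup>2)"
    unfolding inner_n_span_left parseval[OF assms]
    by (simp add: sum_distrib_left sum_subtractf algebra_simps power2_eq_square)
  finally have fit: "(L2_set (\<lambda>i. y i - ?v i) {1..n})\<^sup>2 / real n = \<dots>" .
  have penalty: "2 * (lambda2 n p)\<^sup>2 * \<sigma>\<^sup>2 * (\<Sum>j=1..p. w j) = (\<Sum>j=1..p. 2 * (lambda2 n p * \<sigma>)\<^sup>2 * w j)"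
    unfolding sum_distrib_left power_mult_distrib by (simp add: mult.assoc)
  show ?thesis
    unfolding adap_criterion_def v fit penalty by (simp add: sum.distrib)
qed

text \<open>
  Whichever minimiser is selected, its criterion does not exceed that of the garrote weights, so the
  quadratic growth terms vanish and every fitted coefficient agrees with the garrote.
\<close>

lemma adap_est_eq:
  assumes ob: "orthogonal_basis n p \<psi>" and n: "n \<ge> 1" and "p \<ge> 1" and \<sigma>: "\<sigma> > 0"
  shows "adap_est n p \<psi> \<sigma> y i
    = (\<Sum>j=1..p. garrote (lambda2 n p * \<sigma>) (theta_tilde n \<psi> y j) * \<psi> j i)"
proof -
  define t where "t = lambda2 n p * \<sigma>"
  have t: "t \<ge> 0"
    using assms by (simp add: t_def lambda2_def)
  let ?x = "theta_tilde n \<psi> y"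
  let ?S = "{1..p} \<rightarrow>\<^sub>E {0..1::real}"
  let ?f = "adap_criterion n p \<psi> \<sigma> y"
  define g where "g = restrict (\<lambda>j. garrote_weight t (?x j)) {1..p}"
  have g: "g \<in> ?S"
    using garrote_weight_bounds[OF t] by (auto simp: g_def)
  have growth: "?f g + (\<Sum>j=1..p. (?x j)\<^sup>2 * (w j - g j)\<^sup>2) \<le> ?f w" if "w \<in> ?S" for w
  proof -
    have "w j \<ge> 0" if "j \<in> {1..p}" for j
      using \<open>w \<in> ?S\<close> that by (auto dest: PiE_mem)
    then show ?thesis
      unfolding adap_criterion_eq[OF ob n] t_def[symmetric]
      using garrote_weight_growth[OF t]
      by (auto simp: g_def sum.distrib[symmetric] simp flip: add.assoc intro!: sum_mono)
  qed
  \<comment> \<open>existence of a minimiser, without which the selected weights would be arbitrary\<close>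
  have "is_arg_min ?f (\<lambda>w. w \<in> ?S) g"
  proof -
    have "?f g \<le> ?f w" if "w \<in> ?S" for w
      using growth[OF that] sum_nonneg[of "{1..p}" "\<lambda>j. (?x j)\<^sup>2 * (w j - g j)\<^sup>2"] by simp
    then show ?thesis
      using g by (auto simp: is_arg_min_linorder)
  qed
  then have "is_arg_min ?f (\<lambda>w. w \<in> ?S) (adap_weights n p \<psi> \<sigma> y)"
    unfolding adap_weights_def arg_min_def by (rule someI[of "is_arg_min _ _"])
  then have w: "adap_weights n p \<psi> \<sigma> y \<in> ?S" "?f (adap_weights n p \<psi> \<sigma> y) \<le> ?f g"
    using g by (auto simp: is_arg_min_linorder)
  let ?w = "adap_weights n p \<psi> \<sigma> y"
  have "(\<Sum>j=1..p. (?x j)\<^sup>2 * (?w j - g j)\<^sup>2) = 0"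
    using growth[OF w(1)] w(2) sum_nonneg[of "{1..p}" "\<lambda>j. (?x j)\<^sup>2 * (?w j - g j)\<^sup>2"] by simp
  then have "(?x j)\<^sup>2 * (?w j - g j)\<^sup>2 = 0" if "j \<in> {1..p}" for j
    using that by (subst (asm) sum_nonneg_eq_0_iff) auto
  then have "?w j * ?x j = garrote t (?x j)" if "j \<in> {1..p}" for j
    using that garrote_weight_mult[OF t, of "?x j"] by (fastforce simp: g_def)
  then show ?thesis
    unfolding adap_est_def single_est_def t_def
    by (intro sum.cong) (auto simp flip: mult.assoc)
qed

lemma garrote_bias:
  assumes "t \<ge> 0"
  shows "\<bar>garrote t x - x\<bar> \<le> t"
proof (cases "\<bar>x\<bar> \<le> t")
  case False
  then have "t * t \<le> t * \<bar>x\<bar>" using assms by (intro mult_left_mono) auto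
  then have "t\<^sup>2 / \<bar>x\<bar> \<le> t"
    using False assms by (auto simp: divide_le_eq power2_eq_square)
  with False show ?thesis
    by (simp add: garrote_def abs_divide)
qed (simp add: garrote_def)

lemma garrote_minus: "garrote t (- x) = - garrote t x"
  by (simp add: garrote_def)

text \<open>
  Above the threshold \<open>garrote t x = (x - t) * (x + t) / x\<close>, and \<open>(x + t) / x \<le> 2\<close>. On pure noise the
  output is therefore controlled by the excess of the noise over the threshold.
\<close>

lemma garrote_abs_le:
  assumes "t \<ge> 0"
  shows "\<bar>garrote t x\<bar> \<le> 2 * max 0 (\<bar>x\<bar> - t)"
proof -
  have pos: "\<bar>garrote t x\<bar> \<le> 2 * max 0 (x - t)" if "x \<ge> 0" for x
  proof (cases "x \<le> t")
    case False
    then have "x > 0" using assms by simp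
    define c where "c = (x + t) / x"
    have "garrote t x = (x - t) * c"
      using False \<open>x > 0\<close> by (simp add: c_def garrote_def field_simps power2_eq_square)
    moreover have "0 \<le> c" "c \<le> 2"
      using False assms \<open>x > 0\<close> by (auto simp: c_def field_simps)
    ultimately show ?thesis
      using False mult_left_mono[of c 2 "x - t"] by (simp add: abs_mult)
  qed (use that in \<open>simp add: garrote_def\<close>)
  show ?thesis
    using pos[of x] pos[of "- x"] by (cases "x \<ge> 0") (auto simp: garrote_minus)
qed

text \<open>
  The derivative \<open>1 + t\<^sup>2 / x\<^sup>2\<close> beyond the threshold is at most 2. Here this is used in the form of the
  difference quotient \<open>1 + t\<^sup>2 / (x * y)\<close> on one side of the dead zone; when the segment between
  the two points meets the dead zone, \<open>garrote_abs_le\<close> applies to each end.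
\<close>

lemma garrote_lipschitz:
  assumes t: "t \<ge> 0"
  shows "\<bar>garrote t x - garrote t y\<bar> \<le> 2 * \<bar>x - y\<bar>"
proof -
  consider "\<bar>x\<bar> \<le> t \<or> \<bar>y\<bar> \<le> t \<or> x * y \<le> 0" | "\<bar>x\<bar> > t" "\<bar>y\<bar> > t" "x * y > 0"
    by linarith
  then show ?thesis
  proof cases
    case 1
    have "\<bar>garrote t x - garrote t y\<bar> \<le> 2 * max 0 (\<bar>x\<bar> - t) + 2 * max 0 (\<bar>y\<bar> - t)"
      using garrote_abs_le[OF t, of x] garrote_abs_le[OF t, of y] by linarith
    moreover have "\<bar>x - y\<bar> = \<bar>x\<bar> + \<bar>y\<bar>" if "x * y \<le> 0"
      using that by (auto simp: mult_le_0_iff)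
    ultimately show ?thesis
      using 1 t abs_triangle_ineq2[of x y] abs_triangle_ineq2_sym[of y x]
      by (auto simp: max_def split: if_splits)
  next
    case 2
    then have "x \<noteq> 0" "y \<noteq> 0" by auto
    have "t * t \<le> \<bar>x\<bar> * \<bar>y\<bar>"
      using 2 t by (intro mult_mono) auto
    then have "t\<^sup>2 / (x * y) \<le> 1" "0 \<le> t\<^sup>2 / (x * y)"
      using 2 by (simp_all add: power2_eq_square flip: abs_mult)
    then have "\<bar>1 + t\<^sup>2 / (x * y)\<bar> \<le> 2" by simp
    moreover have "garrote t x - garrote t y = (1 + t\<^sup>2 / (x * y)) * (x - y)"
      using 2 \<open>x \<noteq> 0\<close> \<open>y \<noteq> 0\<close> by (simp add: garrote_def field_simps)
    ultimately show ?thesis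
      by (simp add: abs_mult mult_right_mono)
  qed
qed

section \<open>The risk of garrote thresholding under Gaussian noise\<close>

lemma integrable_normal_square:
  assumes "s > 0"
  shows "integrable lborel (\<lambda>x. normal_density 0 s x * x\<^sup>2)"
  using integrable_normal_moment[OF assms, of 0 2] by simp

lemma integral_normal_square:
  assumes "s > 0"
  shows "(\<integral>x. normal_density 0 s x * x\<^sup>2 \<partial>lborel) = s\<^sup>2"
  using integral_normal_moment_even[OF assms, of 0 1] assms by simp

text \<open>
  The exponent of the shifted density contains \<open>(t + u)\<^sup>2 \<ge> t\<^sup>2 + u\<^sup>2\<close>.
\<close>

lemma normal_density_shift_le:
  assumes "s > 0" "t * u \<ge> 0"
  shows "normal_density 0 s (t + u) \<le> exp (- (t\<^sup>2 / (2 * s\<^sup>2))) * normal_density 0 s u"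
proof -
  have "- (t + u)\<^sup>2 / (2 * s\<^sup>2) \<le> - (t\<^sup>2 / (2 * s\<^sup>2)) + - u\<^sup>2 / (2 * s\<^sup>2)"
    using assms by (simp add: field_simps power2_eq_square)
  then have "exp (- (t + u)\<^sup>2 / (2 * s\<^sup>2))
      \<le> exp (- (t\<^sup>2 / (2 * s\<^sup>2))) * exp (- u\<^sup>2 / (2 * s\<^sup>2))"
    by (simp flip: exp_add)
  then have "1 / sqrt (2 * pi * s\<^sup>2) * exp (- (t + u)\<^sup>2 / (2 * s\<^sup>2))
      \<le> 1 / sqrt (2 * pi * s\<^sup>2) * (exp (- (t\<^sup>2 / (2 * s\<^sup>2))) * exp (- u\<^sup>2 / (2 * s\<^sup>2)))"
    by (rule mult_left_mono) simp
  then show ?thesis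
    by (simp add: normal_density_def mult_ac)
qed

text \<open>
  Each of the two tails is moved to the origin by a shift of length \<open>t\<close>, which costs the factor
  \<open>exp (- t\<^sup>2 / (2 * s\<^sup>2))\<close>; the two shifted tails together give the full second moment \<open>s\<^sup>2\<close>.
  For \<open>t\<^sup>2 = 2 * s\<^sup>2 * ln p\<close> the factor is exactly \<open>1 / p\<close>.
\<close>

lemma normal_excess_second_moment:
  assumes s: "s > 0" and t: "t \<ge> 0"
  shows "(\<integral>x. normal_density 0 s x * (max 0 (\<bar>x\<bar> - t))\<^sup>2 \<partial>lborel) \<le> s\<^sup>2 * exp (- (t\<^sup>2 / (2 * s\<^sup>2)))"
proof -
  let ?\<phi> = "normal_density 0 s" and ?E = "exp (- (t\<^sup>2 / (2 * s\<^sup>2)))"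
  have dom: "integrable lborel (\<lambda>x. ?\<phi> x * (h x)\<^sup>2)"
    if [measurable]: "h \<in> borel_measurable borel" and "\<And>x. \<bar>h x\<bar> \<le> \<bar>x\<bar>" for h
    by (rule Bochner_Integration.integrable_bound[OF integrable_normal_square[OF s]])
       (auto simp: abs_mult abs_le_square_iff[symmetric] that intro!: AE_I2 mult_left_mono)
  \<comment> \<open>the sign \<open>c\<close> selects the right or the left tail\<close>
  have tail: "(\<integral>x. ?\<phi> x * (max 0 (c * x - t))\<^sup>2 \<partial>lborel) \<le> ?E * (\<integral>u. ?\<phi> u * (max 0 (c * u))\<^sup>2 \<partial>lborel)"
    if c: "c = 1 \<or> c = -1" for c
  proof -
    have "integrable lborel (\<lambda>x. ?\<phi> x * (max 0 (c * x - t))\<^sup>2)"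
      by (rule dom) (use c t in auto)
    then have "integrable lborel (\<lambda>u. ?\<phi> (c * t + 1 * u) * (max 0 (c * (c * t + 1 * u) - t))\<^sup>2)"
      by (rule lborel_integrable_real_affine) simp
    then have shifted: "integrable lborel (\<lambda>u. ?\<phi> (c * t + u) * (max 0 (c * u))\<^sup>2)"
      using c by (auto simp: algebra_simps)
    have "(\<integral>x. ?\<phi> x * (max 0 (c * x - t))\<^sup>2 \<partial>lborel) = (\<integral>u. ?\<phi> (c * t + u) * (max 0 (c * u))\<^sup>2 \<partial>lborel)"
      using c by (subst lborel_integral_real_affine[where c=1 and t="c * t"]) (auto simp: algebra_simps)
    also have "\<dots> \<le> (\<integral>u. ?E * (?\<phi> u * (max 0 (c * u))\<^sup>2) \<partial>lborel)"
    proof (rule integral_mono[OF shifted])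
      show "integrable lborel (\<lambda>u. ?E * (?\<phi> u * (max 0 (c * u))\<^sup>2))"
        by (intro integrable_mult_right dom) (use c in auto)
    next
      fix u
      show "?\<phi> (c * t + u) * (max 0 (c * u))\<^sup>2 \<le> ?E * (?\<phi> u * (max 0 (c * u))\<^sup>2)"
      proof (cases "c * u \<ge> 0")
        case True
        then have "(c * t) * u \<ge> 0"
          using t by (metis mult.assoc mult.commute mult_nonneg_nonneg)
        from normal_density_shift_le[OF s this] have "?\<phi> (c * t + u) \<le> ?E * ?\<phi> u"
          using c by (auto simp: power_mult_distrib)
        then show ?thesis
          by (simp add: mult_right_mono flip: mult.assoc)
      qed simp
    qed
    finally show ?thesis by simp
  qed
  have "(\<integral>x. ?\<phi> x * (max 0 (\<bar>x\<bar> - t))\<^sup>2 \<partial>lborel)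
      = (\<integral>x. ?\<phi> x * (max 0 (1 * x - t))\<^sup>2 + ?\<phi> x * (max 0 (-1 * x - t))\<^sup>2 \<partial>lborel)"
    using t by (intro Bochner_Integration.integral_cong refl) (auto simp: max_def abs_if)
  also have "\<dots> = (\<integral>x. ?\<phi> x * (max 0 (1 * x - t))\<^sup>2 \<partial>lborel) + (\<integral>x. ?\<phi> x * (max 0 (-1 * x - t))\<^sup>2 \<partial>lborel)"
    using t by (intro Bochner_Integration.integral_add dom) auto
  also have "\<dots> \<le> ?E * (\<integral>u. ?\<phi> u * (max 0 (1 * u))\<^sup>2 \<partial>lborel) + ?E * (\<integral>u. ?\<phi> u * (max 0 (-1 * u))\<^sup>2 \<partial>lborel)"
    by (intro add_mono tail) auto
  also have "\<dots> = ?E * ((\<integral>u. ?\<phi> u * (max 0 (1 * u))\<^sup>2 \<partial>lborel) + (\<integral>u. ?\<phi> u * (max 0 (-1 * u))\<^sup>2 \<partial>lborel))"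
    by (rule distrib_left[symmetric])
  also have "(\<integral>u. ?\<phi> u * (max 0 (1 * u))\<^sup>2 \<partial>lborel) + (\<integral>u. ?\<phi> u * (max 0 (-1 * u))\<^sup>2 \<partial>lborel)
      = (\<integral>u. ?\<phi> u * (max 0 (1 * u))\<^sup>2 + ?\<phi> u * (max 0 (-1 * u))\<^sup>2 \<partial>lborel)"
    by (intro Bochner_Integration.integral_add[symmetric] dom) auto
  also have "(\<integral>u. ?\<phi> u * (max 0 (1 * u))\<^sup>2 + ?\<phi> u * (max 0 (-1 * u))\<^sup>2 \<partial>lborel) = (\<integral>u. ?\<phi> u * u\<^sup>2 \<partial>lborel)"
    by (intro Bochner_Integration.integral_cong refl) (auto simp: max_def)
  finally show ?thesis
    using integral_normal_square[OF s] by (simp add: mult.commute)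
qed

lemma garrote_measurable[measurable]: "garrote t \<in> borel_measurable borel"
  unfolding garrote_def[abs_def] by measurable

context
  fixes M :: "'a measure" and X :: "'a \<Rightarrow> real" and s :: real
  assumes prob: "prob_space M"
    and X: "distributed M lborel X (normal_density 0 s)"
    and s: "s > 0"
begin

lemma normal_rv_measurable: "X \<in> borel_measurable M"
  using distributed_measurable[OF X] by simp

lemma normal_rv_integral:
  "g \<in> borel_measurable borel \<Longrightarrow> (\<integral>\<omega>. g (X \<omega>) \<partial>M) = (\<integral>x. normal_density 0 s x * g x \<partial>lborel)"
  using distributed_integral[OF X, of g] by simp

lemma normal_rv_square:
  "integrable M (\<lambda>\<omega>. (X \<omega>)\<^sup>2)" "(\<integral>\<omega>. (X \<omega>)\<^sup>2 \<partial>M) = s\<^sup>2"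
  using distributed_integrable[OF X, of "\<lambda>x. x\<^sup>2"] normal_rv_integral[of "\<lambda>x. x\<^sup>2"]
    integrable_normal_square[OF s] integral_normal_square[OF s] by simp_all

lemma normal_rv_mean: "integrable M X" "(\<integral>\<omega>. X \<omega> \<partial>M) = 0"
  using distributed_integrable_var[OF X] integrable_normal_moment[OF s, of 0 1]
    prob_space.normal_distributed_expectation[OF prob s X] by simp_all

lemma integrable_garrote_loss: "t \<ge> 0 \<Longrightarrow> integrable M (\<lambda>\<omega>. (garrote t (\<theta> + X \<omega>) - \<theta>)\<^sup>2)"
proof -
  assume t: "t \<ge> 0"
  interpret prob_space M by (rule prob)
  note [measurable] = normal_rv_measurable
  show ?thesis
  proof (rule Bochner_Integration.integrable_bound)
    show "integrable M (\<lambda>\<omega>. 2 * (X \<omega>)\<^sup>2 + 2 * t\<^sup>2)"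
      using normal_rv_square by simp
    show "AE \<omega> in M. norm ((garrote t (\<theta> + X \<omega>) - \<theta>)\<^sup>2) \<le> norm (2 * (X \<omega>)\<^sup>2 + 2 * t\<^sup>2)"
    proof (rule AE_I2)
      fix \<omega>
      have "\<bar>garrote t (\<theta> + X \<omega>) - \<theta>\<bar> \<le> \<bar>X \<omega>\<bar> + t"
        using garrote_bias[OF t, of "\<theta> + X \<omega>"] by linarith
      then have "(garrote t (\<theta> + X \<omega>) - \<theta>)\<^sup>2 \<le> (\<bar>X \<omega>\<bar> + t)\<^sup>2"
        by (metis abs_ge_zero power2_abs power_mono)
      also have "\<dots> \<le> 2 * (X \<omega>)\<^sup>2 + 2 * t\<^sup>2"
        using zero_le_power2[of "\<bar>X \<omega>\<bar> - t"] by (simp add: power2_sum power2_diff)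
      finally show "norm ((garrote t (\<theta> + X \<omega>) - \<theta>)\<^sup>2) \<le> norm (2 * (X \<omega>)\<^sup>2 + 2 * t\<^sup>2)"
        by simp
    qed
  qed measurable
qed

text \<open>
  The error is at most \<open>\<bar>X\<bar> + a * s\<close>. The Cauchy-Schwarz form
  \<open>(\<bar>X\<bar> + a * s)\<^sup>2 \<le> (1 + a) * (X\<^sup>2 + a * s\<^sup>2)\<close>, with weights 1 and \<open>a\<close>, gives the leading term
  \<open>a\<^sup>2 * s\<^sup>2\<close> with constant 1, which the sharp constant in \<open>2 * ln p\<close> depends on.
\<close>

lemma garrote_risk_le_noise:
  assumes a: "a \<ge> 0"
  shows "(\<integral>\<omega>. (garrote (a * s) (\<theta> + X \<omega>) - \<theta>)\<^sup>2 \<partial>M) \<le> (1 + a)\<^sup>2 * s\<^sup>2"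
proof -
  interpret prob_space M by (rule prob)
  have t: "a * s \<ge> 0" using a s by simp
  have "(\<integral>\<omega>. (garrote (a * s) (\<theta> + X \<omega>) - \<theta>)\<^sup>2 \<partial>M) \<le> (\<integral>\<omega>. (1 + a) * ((X \<omega>)\<^sup>2 + a * s\<^sup>2) \<partial>M)"
  proof (rule integral_mono[OF integrable_garrote_loss[OF t]])
    show "integrable M (\<lambda>\<omega>. (1 + a) * ((X \<omega>)\<^sup>2 + a * s\<^sup>2))"
      using normal_rv_square by simp
  next
    fix \<omega>
    have "\<bar>garrote (a * s) (\<theta> + X \<omega>) - \<theta>\<bar> \<le> \<bar>X \<omega>\<bar> + a * s"
      using garrote_bias[OF t, of "\<theta> + X \<omega>"] by linarith
    then have "(garrote (a * s) (\<theta> + X \<omega>) - \<theta>)\<^sup>2 \<le> (\<bar>X \<omega>\<bar> + a * s)\<^sup>2"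
      by (metis abs_ge_zero power2_abs power_mono)
    also have "\<dots> = (1 + a) * ((X \<omega>)\<^sup>2 + a * s\<^sup>2) - a * (\<bar>X \<omega>\<bar> - s)\<^sup>2"
      by (simp add: power2_sum power2_diff algebra_simps power2_eq_square)
    also have "\<dots> \<le> (1 + a) * ((X \<omega>)\<^sup>2 + a * s\<^sup>2)"
      using a by simp
    finally show "(garrote (a * s) (\<theta> + X \<omega>) - \<theta>)\<^sup>2 \<le> (1 + a) * ((X \<omega>)\<^sup>2 + a * s\<^sup>2)" .
  qed
  also have "\<dots> = (1 + a)\<^sup>2 * s\<^sup>2"
    using normal_rv_square by (simp add: prob_space algebra_simps power2_eq_square)
  finally show ?thesis .
qed

text \<open>
  By the Lipschitz bound the error at signal \<open>\<theta>\<close> differs from the output on pure noise by at most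
  \<open>3 * \<bar>\<theta>\<bar>\<close>: twice \<open>\<bar>\<theta>\<bar>\<close> from the shift of the argument and once from the centring. The
  constants 8 and 18 come from \<open>(m + b)\<^sup>2 \<le> 2 * m\<^sup>2 + 2 * b\<^sup>2\<close>; their size does not affect the
  asymptotics, since 8 enters only the remainder and 18 is added to the growing \<open>(1 + a)\<^sup>2\<close> in
  \<open>garrote_risk_le_oracle\<close>.
\<close>

lemma garrote_risk_le_signal:
  assumes t: "t \<ge> 0"
  shows "(\<integral>\<omega>. (garrote t (\<theta> + X \<omega>) - \<theta>)\<^sup>2 \<partial>M) \<le> 8 * s\<^sup>2 * exp (- (t\<^sup>2 / (2 * s\<^sup>2))) + 18 * \<theta>\<^sup>2"
proof -
  interpret prob_space M by (rule prob)
  note [measurable] = normal_rv_measurable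
  have int: "integrable M (\<lambda>\<omega>. (max 0 (\<bar>X \<omega>\<bar> - t))\<^sup>2)"
    by (rule Bochner_Integration.integrable_bound[OF normal_rv_square(1)])
       (use t in \<open>auto simp: abs_le_square_iff[symmetric] intro!: AE_I2\<close>)
  have "(\<integral>\<omega>. (garrote t (\<theta> + X \<omega>) - \<theta>)\<^sup>2 \<partial>M) \<le> (\<integral>\<omega>. 8 * (max 0 (\<bar>X \<omega>\<bar> - t))\<^sup>2 + 18 * \<theta>\<^sup>2 \<partial>M)"
  proof (rule integral_mono[OF integrable_garrote_loss[OF t]])
    show "integrable M (\<lambda>\<omega>. 8 * (max 0 (\<bar>X \<omega>\<bar> - t))\<^sup>2 + 18 * \<theta>\<^sup>2)"
      using int by simp
  next
    fix \<omega>
    have "\<bar>garrote t (\<theta> + X \<omega>) - \<theta>\<bar> \<le> 2 * max 0 (\<bar>X \<omega>\<bar> - t) + 3 * \<bar>\<theta>\<bar>" (is "_ \<le> ?m + ?b")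
      using garrote_lipschitz[OF t, of "\<theta> + X \<omega>" "X \<omega>"] garrote_abs_le[OF t, of "X \<omega>"]
      by simp
    then have "(garrote t (\<theta> + X \<omega>) - \<theta>)\<^sup>2 \<le> (?m + ?b)\<^sup>2"
      by (metis abs_ge_zero power2_abs power_mono)
    also have "\<dots> \<le> 2 * ?m\<^sup>2 + 2 * ?b\<^sup>2"
      using zero_le_power2[of "?m - ?b"] unfolding power2_sum power2_diff by linarith
    also have "\<dots> = 8 * (max 0 (\<bar>X \<omega>\<bar> - t))\<^sup>2 + 18 * \<theta>\<^sup>2"
      by (simp add: power_mult_distrib)
    finally show "(garrote t (\<theta> + X \<omega>) - \<theta>)\<^sup>2 \<le> 8 * (max 0 (\<bar>X \<omega>\<bar> - t))\<^sup>2 + 18 * \<theta>\<^sup>2" .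
  qed
  also have "\<dots> = 8 * (\<integral>\<omega>. (max 0 (\<bar>X \<omega>\<bar> - t))\<^sup>2 \<partial>M) + 18 * \<theta>\<^sup>2"
    using int by (simp add: prob_space)
  also have "(\<integral>\<omega>. (max 0 (\<bar>X \<omega>\<bar> - t))\<^sup>2 \<partial>M) \<le> s\<^sup>2 * exp (- (t\<^sup>2 / (2 * s\<^sup>2)))"
    using normal_excess_second_moment[OF s t] normal_rv_integral[of "\<lambda>x. (max 0 (\<bar>x\<bar> - t))\<^sup>2"] by simp
  finally show ?thesis by simp
qed

text \<open>
  With the remainder \<open>\<tau>\<close> subtracted, the risk \<open>r\<close> satisfies \<open>r * s\<^sup>2 \<le> 18 * (\<theta>\<^sup>2 * s\<^sup>2)\<close> and
  \<open>r * \<theta>\<^sup>2 \<le> (1 + a)\<^sup>2 * (\<theta>\<^sup>2 * s\<^sup>2)\<close>; adding the two inequalities interpolates between them without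
  splitting into small and large signals.
\<close>

lemma garrote_risk_le_oracle:
  assumes a: "a \<ge> 0"
  shows "(\<integral>\<omega>. (garrote (a * s) (\<theta> + X \<omega>) - \<theta>)\<^sup>2 \<partial>M)
    \<le> 8 * s\<^sup>2 * exp (- (a\<^sup>2 / 2)) + (18 + (1 + a)\<^sup>2) * (\<theta>\<^sup>2 * s\<^sup>2 / (\<theta>\<^sup>2 + s\<^sup>2))"
proof -
  define \<tau> where "\<tau> = 8 * s\<^sup>2 * exp (- (a\<^sup>2 / 2))"
  define r where "r = (\<integral>\<omega>. (garrote (a * s) (\<theta> + X \<omega>) - \<theta>)\<^sup>2 \<partial>M) - \<tau>"
  have "(a * s)\<^sup>2 / (2 * s\<^sup>2) = a\<^sup>2 / 2"
    using s by (simp add: power_mult_distrib)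
  from garrote_risk_le_signal[of "a * s" \<theta>, unfolded this] have "r \<le> 18 * \<theta>\<^sup>2"
    using a s by (simp add: r_def \<tau>_def)
  then have "r * s\<^sup>2 \<le> 18 * \<theta>\<^sup>2 * s\<^sup>2"
    by (rule mult_right_mono) simp
  moreover have "\<tau> \<ge> 0"
    by (simp add: \<tau>_def)
  then have "r \<le> (1 + a)\<^sup>2 * s\<^sup>2"
    using garrote_risk_le_noise[OF a, of \<theta>] by (simp add: r_def)
  then have "r * \<theta>\<^sup>2 \<le> (1 + a)\<^sup>2 * s\<^sup>2 * \<theta>\<^sup>2"
    by (rule mult_right_mono) simp
  ultimately have "r * (\<theta>\<^sup>2 + s\<^sup>2) \<le> (18 + (1 + a)\<^sup>2) * (\<theta>\<^sup>2 * s\<^sup>2)"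
    by (simp add: algebra_simps)
  moreover have "\<theta>\<^sup>2 + s\<^sup>2 > 0"
    using s by (simp add: add_nonneg_pos)
  ultimately have "r \<le> (18 + (1 + a)\<^sup>2) * (\<theta>\<^sup>2 * s\<^sup>2) / (\<theta>\<^sup>2 + s\<^sup>2)"
    by (simp add: pos_le_divide_eq)
  then show ?thesis
    by (simp add: r_def \<tau>_def)
qed

lemma integrable_linear_loss: "integrable M (\<lambda>\<omega>. (c * (\<theta> + X \<omega>) - \<theta>)\<^sup>2)"
proof -
  interpret prob_space M by (rule prob)
  have eq: "(c * (\<theta> + X \<omega>) - \<theta>)\<^sup>2 = c\<^sup>2 * (X \<omega>)\<^sup>2 + 2 * c * (c - 1) * \<theta> * X \<omega> + (c - 1)\<^sup>2 * \<theta>\<^sup>2" for \<omega>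
    by (simp add: power2_eq_square algebra_simps)
  show ?thesis
    unfolding eq using normal_rv_square normal_rv_mean by simp
qed

text \<open>
  The risk is \<open>c\<^sup>2 * s\<^sup>2 + (c - 1)\<^sup>2 * \<theta>\<^sup>2\<close>, minimal at \<open>c = \<theta>\<^sup>2 / (\<theta>\<^sup>2 + s\<^sup>2)\<close>.
\<close>

lemma linear_risk_ge_oracle:
  "(\<integral>\<omega>. (c * (\<theta> + X \<omega>) - \<theta>)\<^sup>2 \<partial>M) \<ge> \<theta>\<^sup>2 * s\<^sup>2 / (\<theta>\<^sup>2 + s\<^sup>2)"
proof -
  interpret prob_space M by (rule prob)
  have eq: "(c * (\<theta> + X \<omega>) - \<theta>)\<^sup>2 = c\<^sup>2 * (X \<omega>)\<^sup>2 + 2 * c * (c - 1) * \<theta> * X \<omega> + (c - 1)\<^sup>2 * \<theta>\<^sup>2" for \<omega>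
    by (simp add: power2_eq_square algebra_simps)
  have "(\<integral>\<omega>. (c * (\<theta> + X \<omega>) - \<theta>)\<^sup>2 \<partial>M) = c\<^sup>2 * s\<^sup>2 + (c - 1)\<^sup>2 * \<theta>\<^sup>2"
    unfolding eq using normal_rv_square normal_rv_mean by (simp add: prob_space)
  moreover have "\<theta>\<^sup>2 + s\<^sup>2 > 0"
    using s by (simp add: add_nonneg_pos)
  moreover have "(c\<^sup>2 * s\<^sup>2 + (c - 1)\<^sup>2 * \<theta>\<^sup>2) * (\<theta>\<^sup>2 + s\<^sup>2) - \<theta>\<^sup>2 * s\<^sup>2 = (c * (\<theta>\<^sup>2 + s\<^sup>2) - \<theta>\<^sup>2)\<^sup>2"
    by algebra
  then have "\<theta>\<^sup>2 * s\<^sup>2 \<le> (c\<^sup>2 * s\<^sup>2 + (c - 1)\<^sup>2 * \<theta>\<^sup>2) * (\<theta>\<^sup>2 + s\<^sup>2)"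
    by (metis diff_ge_0_iff_ge zero_le_power2)
  ultimately show ?thesis
    by (simp add: pos_divide_le_eq)
qed

end

section \<open>Comparison of the two risks\<close>

text \<open>
  Summing the scalar bounds, the adaptive risk is at most \<open>8 * \<sigma>\<^sup>2 / n + K * L\<close> with \<open>K = 18 + (1 + a)\<^sup>2\<close>,
  while the optimal all-subset risk is at least the sum \<open>L\<close> of the ideal scalar risks.
\<close>

lemma max_risk_ratio_le:
  assumes \<sigma>: "\<sigma> > 0" and p: "1 \<le> p" and n: "1 \<le> n"
    and prob: "prob_space M"
    and ob: "orthogonal_basis n p \<psi>"
    and X: "\<And>j. j \<in> {1..p} \<Longrightarrow> distributed M lborel
             (\<lambda>\<omega>. inner_n n (\<psi> j) (\<lambda>i. \<epsilon> i \<omega>) / real n)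
             (normal_density 0 (sqrt (\<sigma>\<^sup>2 / real n)))"
  shows "max_risk_ratio M n p \<epsilon> \<psi> \<sigma>
    \<le> ereal (max (8 * \<sigma>\<^sup>2) (18 + (1 + sqrt (2 * ln (real p)))\<^sup>2))" (is "_ \<le> ereal ?C")
proof -
  define s where "s = sqrt (\<sigma>\<^sup>2 / real n)"
  define a where "a = sqrt (2 * ln (real p))"
  define e where "e = (\<lambda>j \<omega>. inner_n n (\<psi> j) (\<lambda>i. \<epsilon> i \<omega>) / real n)"
  define K where "K = 18 + (1 + a)\<^sup>2"
  have s: "s > 0" and s2: "s\<^sup>2 = \<sigma>\<^sup>2 / real n" and a: "a \<ge> 0" and "K \<ge> 0"
    using \<sigma> n p by (simp_all add: s_def a_def K_def)
  have thr: "lambda2 n p * \<sigma> = a * s"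
    using \<sigma> by (simp add: lambda2_def a_def s_def real_sqrt_divide real_sqrt_mult)
  have exp_a: "exp (- (a\<^sup>2 / 2)) = 1 / real p"
    using p by (simp add: a_def exp_minus inverse_eq_divide)
  have D: "distributed M lborel (e j) (normal_density 0 s)" if "j \<in> {1..p}" for j
    using X[OF that] by (simp add: e_def s_def)
  have "risk M n \<epsilon> (adap_est n p \<psi> \<sigma>) \<mu> / (1 / real n + AS_opt_risk M n p \<epsilon> \<psi> \<mu>) \<le> ?C"
    if "\<mu> \<in> lin_span \<psi> {1..p}" for \<mu>
  proof -
    obtain \<theta> where \<mu>: "\<mu> = (\<lambda>i. \<Sum>j=1..p. \<theta> j * \<psi> j i)"
      using \<open>\<mu> \<in> lin_span \<psi> {1..p}\<close> by (auto simp: lin_span_def)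
    have coord: "theta_tilde n \<psi> (\<lambda>k. (\<Sum>j=1..p. \<theta> j * \<psi> j k) + \<epsilon> k \<omega>) j = \<theta> j + e j \<omega>"
      if "j \<in> {1..p}" for j \<omega>
      using theta_tilde_signal_plus_noise[OF ob n that] by (simp add: e_def)
    define L where "L = (\<Sum>j=1..p. (\<theta> j)\<^sup>2 * s\<^sup>2 / ((\<theta> j)\<^sup>2 + s\<^sup>2))"
    have "L \<ge> 0"
      by (auto simp: L_def intro!: sum_nonneg)
    have "risk M n \<epsilon> (adap_est n p \<psi> \<sigma>) \<mu>
        = (\<integral>\<omega>. (\<Sum>j=1..p. (garrote (a * s) (\<theta> j + e j \<omega>) - \<theta> j)\<^sup>2) \<partial>M)"
      unfolding \<mu>
    proof (rule risk_coordinates[OF ob n])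
      fix \<omega> i
      show "adap_est n p \<psi> \<sigma> (\<lambda>k. (\<Sum>j=1..p. \<theta> j * \<psi> j k) + \<epsilon> k \<omega>) i
          = (\<Sum>j=1..p. garrote (a * s) (\<theta> j + e j \<omega>) * \<psi> j i)"
        unfolding adap_est_eq[OF ob n p \<sigma>] thr by (intro sum.cong) (simp_all only: coord)
    qed
    also have "\<dots> = (\<Sum>j=1..p. \<integral>\<omega>. (garrote (a * s) (\<theta> j + e j \<omega>) - \<theta> j)\<^sup>2 \<partial>M)"
      using a s by (intro Bochner_Integration.integral_sum integrable_garrote_loss[OF prob D s]) auto
    also have "\<dots> \<le> (\<Sum>j=1..p. 8 * s\<^sup>2 / real p + K * ((\<theta> j)\<^sup>2 * s\<^sup>2 / ((\<theta> j)\<^sup>2 + s\<^sup>2)))"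
      using garrote_risk_le_oracle[OF prob D s a] by (intro sum_mono) (simp add: exp_a K_def)
    also have "\<dots> = 8 * s\<^sup>2 + K * L"
      using p by (simp add: sum.distrib L_def sum_distrib_left)
    finally have adap: "risk M n \<epsilon> (adap_est n p \<psi> \<sigma>) \<mu> \<le> 8 * s\<^sup>2 + K * L" .
    have "L \<le> risk M n \<epsilon> (AS_est n p \<psi> w) \<mu>" for w
    proof -
      define c where "c = (\<lambda>j. \<Sum>I | I \<subseteq> {1..p} \<and> j \<in> I. w I)"
      have "risk M n \<epsilon> (AS_est n p \<psi> w) \<mu> = (\<integral>\<omega>. (\<Sum>j=1..p. (c j * (\<theta> j + e j \<omega>) - \<theta> j)\<^sup>2) \<partial>M)"
        unfolding \<mu>
      proof (rule risk_coordinates[OF ob n])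
        fix \<omega> i
        show "AS_est n p \<psi> w (\<lambda>k. (\<Sum>j=1..p. \<theta> j * \<psi> j k) + \<epsilon> k \<omega>) i
            = (\<Sum>j=1..p. (c j * (\<theta> j + e j \<omega>)) * \<psi> j i)"
          unfolding AS_est_eq[OF ob n] c_def by (intro sum.cong) (simp_all only: coord)
      qed
      also have "\<dots> = (\<Sum>j=1..p. \<integral>\<omega>. (c j * (\<theta> j + e j \<omega>) - \<theta> j)\<^sup>2 \<partial>M)"
        by (intro Bochner_Integration.integral_sum integrable_linear_loss[OF prob D s])
      also have "\<dots> \<ge> L"
        unfolding L_def by (intro sum_mono linear_risk_ge_oracle[OF prob D s])
      finally show ?thesis .
    qed
    then have opt: "L \<le> AS_opt_risk M n p \<epsilon> \<psi> \<mu>"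
      unfolding AS_opt_risk_def by (intro cINF_greatest AS_weights_nonempty)
    have "?C \<ge> 0" by (simp add: max_def)
    have "8 * s\<^sup>2 + K * L \<le> ?C * (1 / real n) + ?C * L"
      using \<open>L \<ge> 0\<close> n
      by (intro add_mono mult_right_mono) (auto simp: s2 K_def a_def field_simps)
    also have "\<dots> \<le> ?C * (1 / real n + AS_opt_risk M n p \<epsilon> \<psi> \<mu>)"
      using mult_left_mono[OF opt \<open>?C \<ge> 0\<close>] by (simp add: distrib_left)
    finally have "risk M n \<epsilon> (adap_est n p \<psi> \<sigma>) \<mu> \<le> ?C * (1 / real n + AS_opt_risk M n p \<epsilon> \<psi> \<mu>)"
      using adap by linarith
    moreover have "1 / real n + AS_opt_risk M n p \<epsilon> \<psi> \<mu> > 0"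
      using opt \<open>L \<ge> 0\<close> n by (intro add_pos_nonneg) auto
    ultimately show ?thesis
      by (simp add: pos_divide_le_eq)
  qed
  then show ?thesis
    unfolding max_risk_ratio_def by (intro SUP_least) (simp only: ereal_less_eq)
qed

theorem theorem3:
  fixes M :: "nat \<Rightarrow> 'a measure"
    and \<epsilon> :: "nat \<Rightarrow> nat \<Rightarrow> 'a \<Rightarrow> real"
    and \<psi> :: "nat \<Rightarrow> nat \<Rightarrow> nat \<Rightarrow> real"
    and p :: "nat \<Rightarrow> nat"
    and n0 :: nat
    and \<sigma> :: real
  assumes "\<sigma> > 0"
    and "\<And>n. n \<ge> n0 \<Longrightarrow> 1 \<le> p n \<and> p n \<le> n"
    and "\<And>n. n \<ge> n0 \<Longrightarrow> noise_model (M n) n \<sigma> (\<epsilon> n)"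
    and "\<And>n. n \<ge> n0 \<Longrightarrow> orthogonal_basis n (p n) (\<psi> n)"
    and "\<And>n j. n \<ge> n0 \<Longrightarrow> j \<in> {1..p n} \<Longrightarrow>
           distributed (M n) lborel
             (\<lambda>\<omega>. inner_n n (\<psi> n j) (\<lambda>i. \<epsilon> n i \<omega>) / real n)
             (normal_density 0 (sqrt (\<sigma>\<^sup>2 / real n)))"
  shows "((\<exists>q. \<forall>n\<ge>n0. p n = q) \<longrightarrow>
            (\<exists>C>1. \<forall>n\<ge>n0. max_risk_ratio (M n) n (p n) (\<epsilon> n) (\<psi> n) \<sigma> \<le> ereal C))
       \<and> (filterlim p at_top sequentially \<longrightarrow>
            (\<exists>\<delta>. \<delta> \<longlonglongrightarrow> 0 \<and>
               (\<forall>\<^sub>F n in sequentially.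
                  max_risk_ratio (M n) n (p n) (\<epsilon> n) (\<psi> n) \<sigma>
                    \<le> ereal ((1 + \<delta> n) * (2 * ln (real (p n)))))))"
proof (intro conjI impI)
  define C where "C = (\<lambda>q. max (8 * \<sigma>\<^sup>2) (18 + (1 + sqrt (2 * ln (real q)))\<^sup>2))"
  have bound: "max_risk_ratio (M n) n (p n) (\<epsilon> n) (\<psi> n) \<sigma> \<le> ereal (C (p n))" if "n \<ge> n0" for n
    unfolding C_def
  proof (rule max_risk_ratio_le)
    show "prob_space (M n)"
      using assms(3)[OF that] by (simp add: noise_model_def)
  qed (use assms(1,2,4,5) that in \<open>auto intro: order_trans\<close>)
  {
    assume "\<exists>q. \<forall>n\<ge>n0. p n = q"
    then obtain q where q: "\<And>n. n \<ge> n0 \<Longrightarrow> p n = q" by blast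
    have "18 + (1 + sqrt (2 * ln (real q)))\<^sup>2 \<le> C q"
      by (simp add: C_def)
    then have "C q > 1"
      using zero_le_power2[of "1 + sqrt (2 * ln (real q))"] by linarith
    moreover have "\<forall>n\<ge>n0. max_risk_ratio (M n) n (p n) (\<epsilon> n) (\<psi> n) \<sigma> \<le> ereal (C q)"
      using bound q by auto
    ultimately show "\<exists>C>1. \<forall>n\<ge>n0. max_risk_ratio (M n) n (p n) (\<epsilon> n) (\<psi> n) \<sigma> \<le> ereal C"
      by blast
  }
  assume p: "filterlim p at_top sequentially"
  define a where "a = (\<lambda>n. sqrt (2 * ln (real (p n))))"
  \<comment> \<open>chosen so that \<open>(1 + \<delta> n) * (a n)\<^sup>2 = 18 + (1 + a n)\<^sup>2\<close>\<close>
  define \<delta> where "\<delta> = (\<lambda>n. (2 * a n + 19) / (a n)\<^sup>2)"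
  have a_lim: "filterlim a at_top sequentially"
  proof -
    have "filterlim (\<lambda>x. sqrt (2 * ln x)) at_top at_top"
      by real_asymp
    from filterlim_compose[OF this filterlim_compose[OF filterlim_real_sequentially p]]
    show ?thesis by (simp add: a_def)
  qed
  have "((\<lambda>x::real. (2 * x + 19) / x\<^sup>2) \<longlongrightarrow> 0) at_top"
    by real_asymp
  from filterlim_compose[OF this a_lim] have "\<delta> \<longlonglongrightarrow> 0"
    by (simp add: \<delta>_def)
  moreover have "\<forall>\<^sub>F n in sequentially. max_risk_ratio (M n) n (p n) (\<epsilon> n) (\<psi> n) \<sigma>
                    \<le> ereal ((1 + \<delta> n) * (2 * ln (real (p n))))"
    using eventually_ge_at_top[of n0] filterlim_at_top_dense[THEN iffD1, OF a_lim, rule_format, of "8 * \<sigma>\<^sup>2"]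
  proof eventually_elim
    case (elim n)
    have "a n > 0"
      using elim(2) by (rule le_less_trans[rotated]) simp
    then have "2 * ln (real (p n)) = (a n)\<^sup>2"
      by (simp add: a_def)
    then have "(1 + \<delta> n) * (2 * ln (real (p n))) = 18 + (1 + a n)\<^sup>2"
      using \<open>a n > 0\<close> by (simp add: \<delta>_def field_simps power2_eq_square)
    moreover have "8 * \<sigma>\<^sup>2 \<le> 18 + (1 + a n)\<^sup>2"
      using elim(2) \<open>a n > 0\<close> zero_le_power2[of "a n"] unfolding power2_sum one_power2 by linarith
    ultimately show ?case
      using bound[OF elim(1)] by (simp add: C_def a_def)
  qed
  ultimately show "\<exists>\<delta>. \<delta> \<longlonglongrightarrow> 0 \<and> (\<forall>\<^sub>F n in sequentially.
      max_risk_ratio (M n) n (p n) (\<epsilon> n) (\<psi> n) \<sigma> \<le> ereal ((1 + \<delta> n) * (2 * ln (real (p n)))))"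
    by blast
qed

end
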